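(* The images in $K$ of the one-parameter subgroups generated by $e_1+\theta(e_1)$ and by $e_1\wedge e_2\otimes e_2+\theta(e_1\wedge e_2\otimes e_2)$ intersect exactly twice; that is, the set $\exp\big(\mathbb{R}(e_1+\theta(e_1))\big)\cap\exp\big(\mathbb{R}(e_1\wedge e_2\otimes e_2+\theta(e_1\wedge e_2\otimes e_2))\big)$ has exactly two elements.
   Context: Let $\mathfrak{g}=\bigoplus_{i=-3}^{3}\mathfrak{g}_i$ be the graded real Lie algebra with $\mathfrak{g}_{-3}=(\Lambda^2\mathbb{R}^2)\otimes\mathbb{R}^2$, $\mathfrak{g}_{-2}=\Lambda^2\mathbb{R}^2$, $\mathfrak{g}_{-1}=\mathbb{R}^2$, $\mathfrak{g}_0=\mathfrak{gl}_2\mathbb{R}$, $\mathfrak{g}_1=(\mathbb{R}^2)^\vee$, $\mathfrak{g}_2=\Lambda^2(\mathbb{R}^2)^\vee$, $\mathfrak{g}_3=(\Lambda^2(\mathbb{R}^2)^\vee)\otimes(\mathbb{R}^2)^\vee$ ($^\vee$ denotes the dual). Elements of $\mathfrak{g}_0$ act on each $\mathfrak{g}_i$ by the natural $\mathfrak{gl}_2\mathbb{R}$-action, and for $v,w,u\in\mathbb{R}^2$, $\alpha,\alpha',\beta\in(\mathbb{R}^2)^\vee$: $[v,w]=2v\wedge w$; $[v\wedge w,u]=3v\wedge w\otimes u$; $[\alpha,\alpha']=-2\alpha\wedge\alpha'$; $[\alpha\wedge\alpha',\beta]=-3\alpha\wedge\alpha'\otimes\beta$; $[\alpha,v]=\alpha(v)\mathrm{id}-3\alpha\otimes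 v$; $[\alpha,v\wedge w]=2\iota_\alpha(v\wedge w)$; $[\alpha\wedge\alpha',v\wedge w]=-(\alpha\wedge\alpha')(v\wedge w)\,\mathrm{id}$; $[\alpha\wedge\alpha',v]=2\iota_v(\alpha\wedge\alpha')$; $[\alpha,v\wedge w\otimes u]=-\alpha(u)v\wedge w$; $[\alpha\wedge\alpha',v\wedge w\otimes u]=(\alpha\wedge\alpha')(v\wedge w)\,u$; $[\alpha\wedge\alpha'\otimes\beta,v]=-\beta(v)\alpha\wedge\alpha'$; $[\alpha\wedge\alpha'\otimes\beta,v\wedge w]=(\alpha\wedge\alpha')(v\wedge w)\,\beta$; $[\alpha\wedge\alpha'\otimes\beta,v\wedge w\otimes u]=-(\alpha\wedge\alpha')(v\wedge w)\,\beta\otimes u$; and $[\mathfrak{g}_i,\mathfrak{g}_j]=0$ if $|i+j|>3$. Here $\alpha\otimes v\in\mathfrak{gl}_2\mathbb{R}$ is $w\mapsto\alpha(w)v$, $(\alpha\wedge\alpha')(v\wedge w)=\alpha(v)\alpha'(w)-\alpha(w)\alpha'(v)$, $\iota_v(\alpha\wedge\alpha')=\alpha(v)\alpha'-\alpha'(v)\alpha$, $\iota_\alpha(v\wedge w)=\alpha(v)w-\alpha(w)v$. ($\mathfrak{g}$ is the split real form of the exceptional simple Lie algebra of type $\mathrm{G}_2$.) Let $\{e_1,e_2\}$ be the standard basis of $\mathbb{R}^2$ and $\{e_1^\vee,e_2^\vee\}$ the dual basis. Let $\theta\in\mathrm{Aut}(\mathfrak{g})$ be the involution with $\theta(e_j)=-e_j^\vee$,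 $\theta(e_1\wedge e_2)=-e_1^\vee\wedge e_2^\vee$, $\theta(e_1\wedge e_2\otimes e_j)=-e_1^\vee\wedge e_2^\vee\otimes e_j^\vee$, $\theta(R)=-R^\top$ for $R\in\mathfrak{gl}_2\mathbb{R}$. Let $\mathcal{G}$ be the unique connected centerless Lie group with Lie algebra $\mathfrak{g}$; then $\mathrm{Ad}:\mathcal{G}\to\mathrm{Aut}(\mathfrak{g})$ is an isomorphism. Let $\hat\theta=\mathrm{Ad}^{-1}(\theta)\in\mathcal{G}$ and let $K=\{k\in\mathcal{G}:\hat\theta k\hat\theta^{-1}=k\}$, a maximal compact subgroup of $\mathcal{G}$ with Lie algebra $\mathfrak{k}=\{X\in\mathfrak{g}:\theta(X)=X\}$. *)

theory Defs
  imports "HOL-Analysis.Analysis"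
begin

section \<open>The graded Lie algebra of type G2\<close>

text \<open>
  Encoding of the graded pieces: the lines \<open>\<Lambda>\<^sup>2(\<real>\<^sup>2)\<close> and \<open>\<Lambda>\<^sup>2(\<real>\<^sup>2)\<^sup>\<vee>\<close> are identified with
  \<^typ>\<open>real\<close> through the basis vectors \<open>e\<^sub>1 \<and> e\<^sub>2\<close> and \<open>e\<^sub>1\<^sup>\<vee> \<and> e\<^sub>2\<^sup>\<vee>\<close>; a covector is given by its
  coordinates in the dual basis, so that \<open>\<alpha>(v) = \<alpha> \<bullet> v\<close>; consequently a tensor \<open>\<omega> \<otimes> u\<close> with
  \<open>\<omega>\<close> in one of these lines is \<open>\<omega> *\<^sub>R u\<close>.  In these coordinates the pairing
  \<open>(\<alpha> \<and> \<alpha>')(v \<and> w)\<close> is the product of \<open>wedge \<alpha> \<alpha>'\<close> and \<open>wedge v w\<close>, and the natural action of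
  \<open>R\<close> in \<open>\<gg>\<ll>\<^sub>2\<close> on \<open>\<Lambda>\<^sup>2(\<real>\<^sup>2)\<close> is multiplication by \<^term>\<open>trace R\<close>.

  An element of the Lie algebra is the tuple of its components of degree -3, -2, ..., 3.
\<close>

type_synonym g2 =
  "(real^2) \<times> real \<times> (real^2) \<times> (real^2^2) \<times> (real^2) \<times> real \<times> (real^2)"

definition wedge :: "real^2 \<Rightarrow> real^2 \<Rightarrow> real"
  where "wedge v w = v$1 * w$2 - v$2 * w$1"

text \<open>Contraction of a vector (covector) \<open>v\<close> with \<open>p\<close> times the basis element of the opposite line:
  the coordinate form of \<open>\<iota>\<^sub>v(\<alpha> \<and> \<alpha>') = \<alpha>(v) \<alpha>' - \<alpha>'(v) \<alpha>\<close>, see \<open>contr_wedge\<close>.\<close>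

definition contr :: "real^2 \<Rightarrow> real \<Rightarrow> real^2"
  where "contr v p = p *\<^sub>R vector [- (v$2), v$1]"

text \<open>The endomorphism \<open>\<alpha> \<otimes> v\<close>, i.e. \<open>w \<mapsto> \<alpha>(w) v\<close>, as a matrix.\<close>

definition tens :: "real^2 \<Rightarrow> real^2 \<Rightarrow> real^2^2"
  where "tens \<alpha> v = (\<chi> i j. v$i * \<alpha>$j)"

fun lie :: "g2 \<Rightarrow> g2 \<Rightarrow> g2" where
  "lie (t, w, v, R, \<alpha>, p, s) (t', w', v', R', \<alpha>', p', s') =
    ( (trace R *\<^sub>R t' + R *v t') - (trace R' *\<^sub>R t + R' *v t)
        + (3 * w) *\<^sub>R v' - (3 * w') *\<^sub>R v,
      trace R * w' - trace R' * w + 2 * wedge v v' - \<alpha> \<bullet> t' + \<alpha>' \<bullet> t,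
      R *v v' - R' *v v + 2 *\<^sub>R contr \<alpha> w' - 2 *\<^sub>R contr \<alpha>' w + p *\<^sub>R t' - p' *\<^sub>R t,
      (R ** R' - R' ** R)
        + (mat (\<alpha> \<bullet> v') - 3 *\<^sub>R tens \<alpha> v') - (mat (\<alpha>' \<bullet> v) - 3 *\<^sub>R tens \<alpha>' v)
        - mat (p * w') + mat (p' * w) - tens s t' + tens s' t,
      - (transpose R *v \<alpha>') + transpose R' *v \<alpha>
        + 2 *\<^sub>R contr v' p - 2 *\<^sub>R contr v p' + w' *\<^sub>R s - w *\<^sub>R s',
      - (trace R * p') + trace R' * p - 2 * wedge \<alpha> \<alpha>' - s \<bullet> v' + s' \<bullet> v,
      - (trace R *\<^sub>R s' + transpose R *v s') + (trace R' *\<^sub>R s + transpose R' *v s)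
        - (3 * p) *\<^sub>R \<alpha>' + (3 * p') *\<^sub>R \<alpha>)"

definition gm3 :: "real^2 \<Rightarrow> g2" where "gm3 t = (t, 0, 0, 0, 0, 0, 0)"
definition gm2 :: "real \<Rightarrow> g2" where "gm2 w = (0, w, 0, 0, 0, 0, 0)"
definition gm1 :: "real^2 \<Rightarrow> g2" where "gm1 v = (0, 0, v, 0, 0, 0, 0)"
definition g0 :: "real^2^2 \<Rightarrow> g2" where "g0 R = (0, 0, 0, R, 0, 0, 0)"
definition gp1 :: "real^2 \<Rightarrow> g2" where "gp1 \<alpha> = (0, 0, 0, 0, \<alpha>, 0, 0)"
definition gp2 :: "real \<Rightarrow> g2" where "gp2 p = (0, 0, 0, 0, 0, p, 0)"
definition gp3 :: "real^2 \<Rightarrow> g2" where "gp3 s = (0, 0, 0, 0, 0, 0, s)"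

fun theta :: "g2 \<Rightarrow> g2" where
  "theta (t, w, v, R, \<alpha>, p, s) = (- s, - p, - \<alpha>, - transpose R, - v, - w, - t)"

lemmas grading_defs = gm3_def gm2_def gm1_def g0_def gp1_def gp2_def gp3_def

lemmas coord_simps = wedge_def contr_def tens_def vec_eq_iff forall_2 sum_2 inner_vec_def
  matrix_vector_mult_def matrix_matrix_mult_def transpose_def trace_def mat_def

lemma contr_wedge: "contr v (wedge \<alpha> \<alpha>') = (\<alpha> \<bullet> v) *\<^sub>R \<alpha>' - (\<alpha>' \<bullet> v) *\<^sub>R \<alpha>"
  by (simp add: coord_simps algebra_simps)

lemma wedge_pairing: "wedge \<alpha> \<alpha>' * wedge v w = (\<alpha> \<bullet> v) * (\<alpha>' \<bullet> w) - (\<alpha> \<bullet> w) * (\<alpha>' \<bullet> v)"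
  by (simp add: coord_simps algebra_simps)

lemma tens_apply: "tens \<alpha> v *v w = (\<alpha> \<bullet> w) *\<^sub>R v"
  by (simp add: coord_simps algebra_simps)

lemma gl_action_wedge: "wedge (R *v v) w + wedge v (R *v w) = trace R * wedge v w"
  by (simp add: coord_simps algebra_simps)

lemma lie_relations:
  "lie (gm1 v) (gm1 w) = gm2 (2 * wedge v w)"
  "lie (gm2 (wedge v w)) (gm1 u) = gm3 (3 *\<^sub>R (wedge v w *\<^sub>R u))"
  "lie (gp1 \<alpha>) (gp1 \<alpha>') = gp2 (- 2 * wedge \<alpha> \<alpha>')"
  "lie (gp2 (wedge \<alpha> \<alpha>')) (gp1 \<beta>) = gp3 (- 3 *\<^sub>R (wedge \<alpha> \<alpha>' *\<^sub>R \<beta>))"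
  "lie (gp1 \<alpha>) (gm1 v) = g0 ((\<alpha> \<bullet> v) *\<^sub>R mat 1 - 3 *\<^sub>R tens \<alpha> v)"
  "lie (gp1 \<alpha>) (gm2 (wedge v w)) = gm1 (2 *\<^sub>R ((\<alpha> \<bullet> v) *\<^sub>R w - (\<alpha> \<bullet> w) *\<^sub>R v))"
  "lie (gp2 (wedge \<alpha> \<alpha>')) (gm2 (wedge v w)) = g0 (- (wedge \<alpha> \<alpha>' * wedge v w) *\<^sub>R mat 1)"
  "lie (gp2 (wedge \<alpha> \<alpha>')) (gm1 v) = gp1 (2 *\<^sub>R ((\<alpha> \<bullet> v) *\<^sub>R \<alpha>' - (\<alpha>' \<bullet> v) *\<^sub>R \<alpha>))"
  "lie (gp1 \<alpha>) (gm3 (wedge v w *\<^sub>R u)) = gm2 (- (\<alpha> \<bullet> u) * wedge v w)"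
  "lie (gp2 (wedge \<alpha> \<alpha>')) (gm3 (wedge v w *\<^sub>R u)) = gm1 ((wedge \<alpha> \<alpha>' * wedge v w) *\<^sub>R u)"
  "lie (gp3 (wedge \<alpha> \<alpha>' *\<^sub>R \<beta>)) (gm1 v) = gp2 (- (\<beta> \<bullet> v) * wedge \<alpha> \<alpha>')"
  "lie (gp3 (wedge \<alpha> \<alpha>' *\<^sub>R \<beta>)) (gm2 (wedge v w)) = gp1 ((wedge \<alpha> \<alpha>' * wedge v w) *\<^sub>R \<beta>)"
  "lie (gp3 (wedge \<alpha> \<alpha>' *\<^sub>R \<beta>)) (gm3 (wedge v w *\<^sub>R u))
     = g0 (- (wedge \<alpha> \<alpha>' * wedge v w) *\<^sub>R tens \<beta> u)"
  "lie (g0 R) (g0 R') = g0 (R ** R' - R' ** R)"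
  "lie (g0 R) (gm1 v) = gm1 (R *v v)"
  "lie (g0 R) (gm2 q) = gm2 (trace R * q)"
  "lie (g0 R) (gm3 (q *\<^sub>R u)) = gm3 ((trace R * q) *\<^sub>R u + q *\<^sub>R (R *v u))"
  "lie (g0 R) (gp1 \<alpha>) = gp1 (- (transpose R *v \<alpha>))"
  "lie (g0 R) (gp2 p) = gp2 (- trace R * p)"
  "lie (g0 R) (gp3 (p *\<^sub>R \<beta>)) = gp3 ((- trace R * p) *\<^sub>R \<beta> - p *\<^sub>R (transpose R *v \<beta>))"
  by (simp_all add: grading_defs coord_simps algebra_simps)

lemma lie_antisym: "lie Y X = - lie X Y"
  by (cases X; cases Y) (simp add: coord_simps algebra_simps)

lemma lie_jacobi: "lie X (lie Y Z) + lie Y (lie Z X) + lie Z (lie X Y) = 0"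
proof (cases X; cases Y; cases Z)
  have neq: "((1::2) = 2) = False" "((2::2) = 1) = False"
    by simp_all
  note component_simps = coord_simps vector_2 neq vector_add_component vector_minus_component
    vector_uminus_component vector_scaleR_component zero_index vec_lambda_beta
    inner_real_def real_scaleR_def if_True if_False refl simp_thms
  fix t w v R \<alpha> p s t' w' v' R' \<alpha>' p' s' t'' w'' v'' R'' \<alpha>'' p'' s''
  assume eqs: "X = (t, w, v, R, \<alpha>, p, s)" "Y = (t', w', v', R', \<alpha>', p', s')"
    "Z = (t'', w'', v'', R'', \<alpha>'', p'', s'')"
  show ?thesis
    unfolding eqs
    apply (simp only: lie.simps plus_prod_def zero_prod_def fst_conv snd_conv prod.inject)
    apply (simp only: component_simps)
    apply (intro conjI; algebra)
    done
qed

lemma theta_theta: "theta (theta X) = X"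
  by (cases X) (simp add: coord_simps)

lemma theta_lie: "theta (lie X Y) = lie (theta X) (theta Y)"
  by (cases X; cases Y) (simp add: coord_simps algebra_simps)

section \<open>The adjoint group, its exponential map and the subgroup K\<close>

text \<open>
  The connected centerless Lie group with this Lie algebra is realized, through the isomorphism
  \<open>Ad\<close>, as the group of Lie algebra automorphisms under composition.  Then \<open>Ad\<close> becomes the
  identity, and the exponential of \<open>X\<close> is the operator exponential of \<open>ad X\<close>.
\<close>

definition G2_group :: "(g2 \<Rightarrow> g2) set"
  where "G2_group = {\<phi>. linear \<phi> \<and> bij \<phi> \<and> (\<forall>X Y. \<phi> (lie X Y) = lie (\<phi> X) (\<phi> Y))}"

lemma theta_in_G2_group: "theta \<in> G2_group"
proof -
  have "linear theta"
  proof (rule linearI)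
    show "theta (X + Y) = theta X + theta Y" for X Y
      by (cases X; cases Y) (simp add: coord_simps)
    show "theta (r *\<^sub>R X) = r *\<^sub>R theta X" for r X
      by (cases X) (simp add: coord_simps)
  qed
  moreover have "bij theta"
    by (rule o_bij[where g = theta]) (simp_all add: fun_eq_iff theta_theta)
  ultimately show ?thesis
    unfolding G2_group_def using theta_lie by blast
qed

definition exp_G :: "g2 \<Rightarrow> (g2 \<Rightarrow> g2)"
  where "exp_G X = (\<lambda>Y. \<Sum>n. (1 / fact n) *\<^sub>R (lie X ^^ n) Y)"

definition K :: "(g2 \<Rightarrow> g2) set"
  where "K = {k \<in> G2_group. theta \<circ> k \<circ> inv theta = k}"

definition one_param_subgroup :: "g2 \<Rightarrow> (g2 \<Rightarrow> g2) set"
  where "one_param_subgroup X = range (\<lambda>t::real. exp_G (t *\<^sub>R X))"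

abbreviation e1 :: "real^2" where "e1 \<equiv> axis 1 1"
abbreviation e2 :: "real^2" where "e2 \<equiv> axis 2 1"

end

theory Submission
  imports Defs
begin

text \<open>
  The roots of \<open>e\<^sub>1\<close> (short) and of \<open>e\<^sub>1 \<and> e\<^sub>2 \<otimes> e\<^sub>2\<close> (long) are strongly orthogonal, so the two
  generators lie in commuting copies of \<open>\<ss>\<ll>\<^sub>2\<close>.  Under the sum of the two copies the Lie algebra
  splits into an even part, the sum itself, of dimension 6, and an odd part of dimension 8, the tensor
  product of the four-dimensional irreducible representation of the short copy with the
  two-dimensional one of the long copy.  This is the splitting by the involution \<open>parity\<close> given
  by the action of \<open>diag(1, -1) \<in> GL\<^sub>2\<close>.  On the even part each generator acts with eigenvalues
  among \<open>0\<close> and \<open>\<plusminus>2\<i>\<close>; on the odd part the short generator has the eigenvalues \<open>\<plusminus>\<i>\<close> and \<open>\<plusminus>3\<i>\<close>, and the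
  long one only \<open>\<plusminus>\<i>\<close>.  Consequently at time \<open>\<pi>\<close> both one-parameter subgroups pass
  through the same nontrivial element \<open>parity\<close>, and at time \<open>k\<pi>\<close> through its \<open>k\<close>-th power
  (\<open>exp_G_short_gen\<close>, \<open>exp_G_long_gen\<close>).

  There is nothing else in the intersection.  The long generator commutes with \<open>e\<^sub>1\<close>, hence a
  common element \<open>exp(tX)\<close> fixes \<open>e\<^sub>1\<close>.  But \<open>exp(tX)\<close> rotates the short copy of \<open>\<ss>\<ll>\<^sub>2\<close> about the axis \<open>X\<close>
  with angle \<open>2t\<close>, and \<open>e\<^sub>1\<close> is not on this axis; so \<open>t\<close> is a multiple of \<open>\<pi>\<close>
  (\<open>short_rotation_fixing_e1\<close>) and the element is the identity or \<open>parity\<close>.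

  That the subgroups lie in \<open>K\<close> rests on two facts: the exponential of a derivation is an
  automorphism (\<open>exp_G_in_G2_group\<close>), and \<open>\<theta>\<close> carries the exponential of \<open>X\<close> to that of \<open>\<theta>(X)\<close>.
\<close>

section \<open>Exponentials of linear operators on Euclidean spaces\<close>

definition op_exp :: "('a::euclidean_space \<Rightarrow> 'a) \<Rightarrow> 'a \<Rightarrow> 'a"
  where "op_exp D Y = (\<Sum>n. (1 / fact n) *\<^sub>R (D ^^ n) Y)"

lemma linear_funpow: "linear D \<Longrightarrow> linear (D ^^ n)"
  for D :: "'a::real_vector \<Rightarrow> 'a"
proof (induction n)
  case (Suc n)
  then show ?case by (simp add: linear_compose[unfolded o_def])
qed (simp add: linear_iff)

lemma op_exp_summable_norm:
  fixes D :: "'a::euclidean_space \<Rightarrow> 'a"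
  assumes "linear D"
  shows "summable (\<lambda>n. norm ((1 / fact n) *\<^sub>R (D ^^ n) Y))"
proof -
  have "bounded_linear D"
    using assms by (rule linear_conv_bounded_linear[THEN iffD1])
  then obtain C where C: "C > 0" "\<And>x. norm (D x) \<le> norm x * C"
    using bounded_linear.pos_bounded by blast
  have pow: "norm ((D ^^ n) Y) \<le> C ^ n * norm Y" for n
  proof (induction n)
    case (Suc n)
    have "norm ((D ^^ Suc n) Y) \<le> norm ((D ^^ n) Y) * C"
      using C by simp
    also have "\<dots> \<le> C ^ n * norm Y * C"
      using Suc C by (simp add: mult_right_mono)
    finally show ?case by (simp add: ac_simps)
  qed simp
  show ?thesis
  proof (rule summable_comparison_test)
    show "summable (\<lambda>n. inverse (fact n) * C ^ n * norm Y)"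
      by (intro summable_mult2 summable_exp)
    show "\<exists>N. \<forall>n\<ge>N. norm (norm ((1 / fact n) *\<^sub>R (D ^^ n) Y)) \<le> inverse (fact n) * C ^ n * norm Y"
      using pow by (auto simp: field_simps)
  qed
qed

lemma op_exp_sums:
  fixes D :: "'a::euclidean_space \<Rightarrow> 'a"
  assumes "linear D"
  shows "(\<lambda>n. (1 / fact n) *\<^sub>R (D ^^ n) Y) sums op_exp D Y"
  unfolding op_exp_def
  by (rule summable_sums[OF summable_norm_cancel[OF op_exp_summable_norm[OF assms]]])

lemma op_exp_intertwine:
  fixes D :: "'a::euclidean_space \<Rightarrow> 'a" and D' :: "'b::euclidean_space \<Rightarrow> 'b"
  assumes "linear D" "linear D'" "linear T" and comm: "\<And>Y. T (D Y) = D' (T Y)"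
  shows "T (op_exp D Y) = op_exp D' (T Y)"
proof -
  have pow: "T ((D ^^ n) Y) = (D' ^^ n) (T Y)" for n
    by (induction n) (simp_all add: comm)
  have "bounded_linear T"
    using assms(3) by (rule linear_conv_bounded_linear[THEN iffD1])
  from bounded_linear.sums[OF this op_exp_sums[OF assms(1), of Y]]
  have "(\<lambda>n. (1 / fact n) *\<^sub>R (D' ^^ n) (T Y)) sums T (op_exp D Y)"
    by (simp add: pow linear_cmul[OF assms(3)])
  then show ?thesis
    using op_exp_sums[OF assms(2), of "T Y"] by (rule sums_unique2)
qed

lemma linear_op_exp:
  fixes D :: "'a::euclidean_space \<Rightarrow> 'a"
  assumes "linear D"
  shows "linear (op_exp D)"
proof (rule linearI)
  show "op_exp D (x + y) = op_exp D x + op_exp D y" for x y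
  proof -
    have "(\<lambda>n. (1 / fact n) *\<^sub>R (D ^^ n) (x + y)) sums (op_exp D x + op_exp D y)"
      using sums_add[OF op_exp_sums[OF assms, of x] op_exp_sums[OF assms, of y]]
      by (simp add: linear_add[OF linear_funpow[OF assms]] scaleR_add_right)
    with op_exp_sums[OF assms, of "x + y"] show ?thesis by (rule sums_unique2)
  qed
  show "op_exp D (r *\<^sub>R x) = r *\<^sub>R op_exp D x" for r x
    using op_exp_intertwine[of D D "scaleR r" x] assms
    by (simp add: linear_cmul linear_scale_self)
qed

text \<open>In coordinates a bilinear map is a finite combination of products of real numbers, so that the
  Cauchy product of real series gives the one for \<open>prod\<close>.\<close>

lemma bilinear_Cauchy_product_sums:
  fixes prod :: "'a::euclidean_space \<Rightarrow> 'b::euclidean_space \<Rightarrow> 'c::real_normed_vector"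
  assumes "bilinear prod"
    and a: "summable (\<lambda>n. norm (a n))" and b: "summable (\<lambda>n. norm (b n))"
  shows "(\<lambda>n. \<Sum>k\<le>n. prod (a k) (b (n - k))) sums prod (\<Sum>n. a n) (\<Sum>n. b n)"
proof -
  have expand: "prod x y = (\<Sum>i\<in>Basis. \<Sum>j\<in>Basis. ((x \<bullet> i) * (y \<bullet> j)) *\<^sub>R prod i j)" for x y
  proof -
    have "prod x y = prod (\<Sum>i\<in>Basis. (x \<bullet> i) *\<^sub>R i) (\<Sum>j\<in>Basis. (y \<bullet> j) *\<^sub>R j)"
      by (simp add: euclidean_representation)
    also have "\<dots> = (\<Sum>(i, j)\<in>Basis \<times> Basis. prod ((x \<bullet> i) *\<^sub>R i) ((y \<bullet> j) *\<^sub>R j))"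
      by (rule bilinear_sum[OF assms(1)])
    also have "\<dots> = (\<Sum>i\<in>Basis. \<Sum>j\<in>Basis. prod ((x \<bullet> i) *\<^sub>R i) ((y \<bullet> j) *\<^sub>R j))"
      by (simp add: sum.cartesian_product)
    finally show ?thesis
      by (simp add: bilinear_lmul[OF assms(1)] bilinear_rmul[OF assms(1)] mult.commute)
  qed
  have coord: "summable (\<lambda>n. norm (c n \<bullet> i))" "suminf c \<bullet> i = (\<Sum>n. c n \<bullet> i)"
    if "summable (\<lambda>n. norm (c n))" "i \<in> Basis"
    for c :: "nat \<Rightarrow> 'd::euclidean_space" and i
  proof -
    show "summable (\<lambda>n. norm (c n \<bullet> i))"
      by (rule summable_comparison_test[OF _ that(1)]) (use that(2) Basis_le_norm in auto)
    show "suminf c \<bullet> i = (\<Sum>n. c n \<bullet> i)"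
      by (rule bounded_linear.suminf[OF bounded_linear_inner_left summable_norm_cancel[OF that(1)]])
  qed
  have "(\<lambda>n. \<Sum>i\<in>Basis. \<Sum>j\<in>Basis. (\<Sum>k\<le>n. (a k \<bullet> i) * (b (n - k) \<bullet> j)) *\<^sub>R prod i j) sums
      (\<Sum>i\<in>Basis. \<Sum>j\<in>Basis. ((suminf a \<bullet> i) * (suminf b \<bullet> j)) *\<^sub>R prod i j)"
    by (intro sums_sum sums_scaleR_left)
       (simp only: coord(2)[OF a] coord(2)[OF b], intro Cauchy_product_sums coord(1) a b)
  moreover have "(\<Sum>i\<in>Basis. \<Sum>j\<in>Basis. (\<Sum>k\<le>n. (a k \<bullet> i) * (b (n - k) \<bullet> j)) *\<^sub>R prod i j)
      = (\<Sum>k\<le>n. prod (a k) (b (n - k)))" for n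
  proof -
    have "(\<Sum>k\<le>n. prod (a k) (b (n - k)))
        = (\<Sum>k\<le>n. \<Sum>i\<in>Basis. \<Sum>j\<in>Basis. ((a k \<bullet> i) * (b (n - k) \<bullet> j)) *\<^sub>R prod i j)"
      by (rule sum.cong[OF refl]) (rule expand)
    also have "\<dots> = (\<Sum>i\<in>Basis. \<Sum>k\<le>n. \<Sum>j\<in>Basis. ((a k \<bullet> i) * (b (n - k) \<bullet> j)) *\<^sub>R prod i j)"
      by (rule sum.swap)
    also have "\<dots> = (\<Sum>i\<in>Basis. \<Sum>j\<in>Basis. \<Sum>k\<le>n. ((a k \<bullet> i) * (b (n - k) \<bullet> j)) *\<^sub>R prod i j)"
      by (intro sum.cong refl sum.swap)
    finally show ?thesis by (simp add: scaleR_sum_left)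
  qed
  ultimately show ?thesis
    using expand[of "suminf a" "suminf b"] by simp
qed

text \<open>Dividing the iterated Leibniz rule by the factorial absorbs the binomial coefficients, and
  leaves a term of a Cauchy product.\<close>

lemma funpow_Leibniz:
  fixes prod :: "'a::real_vector \<Rightarrow> 'b::real_vector \<Rightarrow> 'c::real_vector"
  assumes "bilinear prod" "linear D\<^sub>3"
    and Leibniz: "\<And>a b. D\<^sub>3 (prod a b) = prod (D\<^sub>1 a) b + prod a (D\<^sub>2 b)"
  shows "(1 / fact n) *\<^sub>R (D\<^sub>3 ^^ n) (prod a b)
    = (\<Sum>k\<le>n. prod ((1 / fact k) *\<^sub>R (D\<^sub>1 ^^ k) a) ((1 / fact (n - k)) *\<^sub>R (D\<^sub>2 ^^ (n - k)) b))"
proof (induction n)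
  case (Suc n)
  let ?A = "\<lambda>k. (1 / fact k) *\<^sub>R (D\<^sub>1 ^^ k) a" and ?B = "\<lambda>k. (1 / fact k) *\<^sub>R (D\<^sub>2 ^^ k) b"
  have lin: "linear (\<lambda>x. prod x y)" "linear (prod x)" for x y
    using assms(1) by (simp_all add: bilinear_def)
  have step: "D\<^sub>3 (prod (?A k) (?B j))
      = real (Suc k) *\<^sub>R prod (?A (Suc k)) (?B j) + real (Suc j) *\<^sub>R prod (?A k) (?B (Suc j))" for k j
  proof -
    have "D\<^sub>3 (prod (?A k) (?B j)) = (1 / (fact k * fact j)) *\<^sub>R D\<^sub>3 (prod ((D\<^sub>1 ^^ k) a) ((D\<^sub>2 ^^ j) b))"
      by (simp add: linear_cmul[OF lin(1)] linear_cmul[OF lin(2)] linear_cmul[OF assms(2)])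
    also have "\<dots> = real (Suc k) *\<^sub>R prod (?A (Suc k)) (?B j) + real (Suc j) *\<^sub>R prod (?A k) (?B (Suc j))"
      by (simp add: Leibniz linear_cmul[OF lin(1)] linear_cmul[OF lin(2)] scaleR_add_right mult.commute
          del: of_nat_Suc)
    finally show ?thesis .
  qed
  \<comment> \<open>Both sides are multiplied by \<open>n + 1\<close>, which splits as \<open>k + (n + 1 - k)\<close>: the first summand
    collects the terms where \<open>D\<^sub>1\<close> was applied, the second those where \<open>D\<^sub>2\<close> was.\<close>
  have "real (Suc n) *\<^sub>R ((1 / fact (Suc n)) *\<^sub>R (D\<^sub>3 ^^ Suc n) (prod a b))
      = D\<^sub>3 ((1 / fact n) *\<^sub>R (D\<^sub>3 ^^ n) (prod a b))"
    by (simp add: linear_cmul[OF assms(2)] del: of_nat_Suc)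
  also have "\<dots> = (\<Sum>k\<le>n. D\<^sub>3 (prod (?A k) (?B (n - k))))"
    unfolding Suc by (rule linear_sum[OF assms(2)])
  also have "\<dots> = (\<Sum>k\<le>n. real (Suc k) *\<^sub>R prod (?A (Suc k)) (?B (Suc n - Suc k)))
      + (\<Sum>k\<le>n. real (Suc n - k) *\<^sub>R prod (?A k) (?B (Suc n - k)))"
    unfolding sum.distrib[symmetric]
  proof (rule sum.cong[OF refl])
    fix k assume "k \<in> {..n}"
    then have "Suc (n - k) = Suc n - k" by auto
    with step[of k "n - k"] show "D\<^sub>3 (prod (?A k) (?B (n - k)))
      = real (Suc k) *\<^sub>R prod (?A (Suc k)) (?B (Suc n - Suc k))
        + real (Suc n - k) *\<^sub>R prod (?A k) (?B (Suc n - k))"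
      by (simp only: diff_Suc_Suc)
  qed
  also have "(\<Sum>k\<le>n. real (Suc k) *\<^sub>R prod (?A (Suc k)) (?B (Suc n - Suc k)))
      = (\<Sum>k\<le>Suc n. real k *\<^sub>R prod (?A k) (?B (Suc n - k)))"
    by (subst sum.atMost_Suc_shift) (simp del: of_nat_Suc)
  also have "(\<Sum>k\<le>n. real (Suc n - k) *\<^sub>R prod (?A k) (?B (Suc n - k)))
      = (\<Sum>k\<le>Suc n. real (Suc n - k) *\<^sub>R prod (?A k) (?B (Suc n - k)))"
    by (subst sum.atMost_Suc) simp
  also have "(\<Sum>k\<le>Suc n. real k *\<^sub>R prod (?A k) (?B (Suc n - k)))
      + (\<Sum>k\<le>Suc n. real (Suc n - k) *\<^sub>R prod (?A k) (?B (Suc n - k)))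
      = real (Suc n) *\<^sub>R (\<Sum>k\<le>Suc n. prod (?A k) (?B (Suc n - k)))"
    unfolding sum.distrib[symmetric] scaleR_sum_right
    by (rule sum.cong[OF refl]) (simp add: of_nat_diff flip: scaleR_add_left)
  finally show ?case
    by (simp only: scaleR_cancel_left
        of_nat_eq_0_iff nat.simps simp_thms)
qed simp

text \<open>Three operators are allowed because two instances are of interest: a derivation of a bracket,
  whose exponential preserves the bracket, and the invariance of a pairing (\<open>D\<^sub>3 = 0\<close>).\<close>

lemma op_exp_bilinear:
  fixes prod :: "'a::euclidean_space \<Rightarrow> 'b::euclidean_space \<Rightarrow> 'c::euclidean_space"
  assumes "bilinear prod" "linear D\<^sub>1" "linear D\<^sub>2" "linear D\<^sub>3"
    and Leibniz: "\<And>a b. D\<^sub>3 (prod a b) = prod (D\<^sub>1 a) b + prod a (D\<^sub>2 b)"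
  shows "op_exp D\<^sub>3 (prod a b) = prod (op_exp D\<^sub>1 a) (op_exp D\<^sub>2 b)"
proof -
  note pow = funpow_Leibniz[of prod D\<^sub>3 D\<^sub>1 D\<^sub>2 _ a b, OF assms(1,4) Leibniz]
  have "(\<lambda>n. (1 / fact n) *\<^sub>R (D\<^sub>3 ^^ n) (prod a b)) sums prod (op_exp D\<^sub>1 a) (op_exp D\<^sub>2 b)"
    using bilinear_Cauchy_product_sums[OF assms(1)
        op_exp_summable_norm[OF assms(2), of a] op_exp_summable_norm[OF assms(3), of b]]
    unfolding op_exp_def by (simp only: pow)
  with op_exp_sums[OF assms(4), of "prod a b"] show ?thesis
    by (rule sums_unique2)
qed

text \<open>The operator \<open>D\<close> and minus its adjoint leave the inner product invariant in the infinitesimal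
  sense, hence so do their exponentials.  Thus \<open>op_exp D\<close> is injective, and bijective in finite
  dimension.\<close>

lemma bij_op_exp:
  fixes D :: "'a::euclidean_space \<Rightarrow> 'a"
  assumes "linear D"
  shows "bij (op_exp D)"
proof -
  let ?D' = "\<lambda>Z. - adjoint D Z"
  have D': "linear ?D'"
    using adjoint_linear[OF assms] by (rule linear_compose_neg)
  have zero: "op_exp (\<lambda>_. 0 :: real) c = c" for c
  proof -
    have "((\<lambda>_. 0 :: real) ^^ n) c = (if n = 0 then c else 0)" for n
      by (cases n) auto
    then have "(\<lambda>n. (1 / fact n) *\<^sub>R ((\<lambda>_. 0 :: real) ^^ n) c) = (\<lambda>n. if n = 0 then c else 0)"
      by auto
    with op_exp_sums[of "\<lambda>_. 0 :: real" c] sums_single[of 0 "\<lambda>_. c"] show ?thesis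
      by (simp add: linear_zero sums_unique2)
  qed
  have inv: "op_exp ?D' Z \<bullet> op_exp D Y = Z \<bullet> Y" for Z Y
  proof -
    have "op_exp (\<lambda>_. 0) (Z \<bullet> Y) = op_exp ?D' Z \<bullet> op_exp D Y"
      by (rule op_exp_bilinear[where prod = inner])
         (use D' assms bounded_bilinear_inner in
           \<open>auto simp: bilinear_conv_bounded_bilinear linear_zero adjoint_clauses\<close>)
    then show ?thesis by (simp add: zero)
  qed
  have "inj (op_exp D)"
  proof (subst linear_injective_0[OF linear_op_exp[OF assms]], intro allI impI)
    fix Y assume "op_exp D Y = 0"
    with inv[of Y Y] show "Y = 0" by simp
  qed
  then show ?thesis
    using linear_injective_imp_surjective[OF linear_op_exp[OF assms]] by (simp add: bij_def)
qed

text \<open>The rotation formula of Rodrigues: the powers of \<open>D\<close> on \<open>A\<close> stay in the span of \<open>A\<close>, \<open>D A\<close> and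
  \<open>D\<^sup>2 A\<close>, where the exponential series becomes a sine and a cosine series.  It needs only the cubic
  relation at the vector \<open>A\<close>, and so applies to each isotypic piece separately.\<close>

lemma op_exp_Rodrigues:
  fixes D :: "'a::euclidean_space \<Rightarrow> 'a"
  assumes "linear D" "l \<noteq> 0" and cubic: "D (D (D A)) = - (l\<^sup>2) *\<^sub>R D A"
  shows "op_exp (\<lambda>Y. t *\<^sub>R D Y) A
    = A + (sin (l * t) / l) *\<^sub>R D A + ((1 - cos (l * t)) / l\<^sup>2) *\<^sub>R D (D A)"
proof -
  let ?tD = "\<lambda>Y. t *\<^sub>R D Y"
  let ?\<delta> = "\<lambda>n::nat. if n = 0 then 1 else 0 :: real"
  have lin: "linear ?tD"
    using assms(1) by (rule linear_compose_scale_right)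
  have pow: "(?tD ^^ n) A = ?\<delta> n *\<^sub>R A + (fact n * sin_coeff n * (l * t) ^ n / l) *\<^sub>R D A
     + ((?\<delta> n - fact n * cos_coeff n * (l * t) ^ n) / l\<^sup>2) *\<^sub>R D (D A)" for n
  proof (induction n)
    case (Suc n)
    have "(?tD ^^ Suc n) A = ?tD ((?tD ^^ n) A)" by simp
    also have "\<dots> = (t * ?\<delta> n) *\<^sub>R D A + (t * (fact n * sin_coeff n * (l * t) ^ n / l)) *\<^sub>R D (D A)
        + (t * ((?\<delta> n - fact n * cos_coeff n * (l * t) ^ n) / l\<^sup>2)) *\<^sub>R D (D (D A))"
      unfolding Suc by (simp add: linear_add[OF assms(1)] linear_cmul[OF assms(1)] scaleR_add_right)
    also have "\<dots> = (t * fact n * cos_coeff n * (l * t) ^ n) *\<^sub>R D A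
        + (t * (fact n * sin_coeff n * (l * t) ^ n / l)) *\<^sub>R D (D A)"
      using assms(2) unfolding cubic scaleR_scaleR
      by (simp add: algebra_simps flip: scaleR_add_left scaleR_diff_left)
    also have "\<dots> = (fact (Suc n) * sin_coeff (Suc n) * (l * t) ^ Suc n / l) *\<^sub>R D A
        + (- (fact (Suc n) * cos_coeff (Suc n) * (l * t) ^ Suc n) / l\<^sup>2) *\<^sub>R D (D A)"
      using assms(2) by (intro arg_cong2[where f = "(+)"] arg_cong2[where f = scaleR] refl)
        (simp_all add: sin_coeff_Suc cos_coeff_Suc field_simps power2_eq_square del: of_nat_Suc)
    finally show ?case by simp
  qed simp
  have summand: "(1 / fact n) *\<^sub>R (?tD ^^ n) A = ?\<delta> n *\<^sub>R A + (sin_coeff n *\<^sub>R (l * t) ^ n / l) *\<^sub>R D A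
     + ((?\<delta> n - cos_coeff n *\<^sub>R (l * t) ^ n) / l\<^sup>2) *\<^sub>R D (D A)" for n
    unfolding pow scaleR_add_right scaleR_scaleR
    by (intro arg_cong2[where f = "(+)"] arg_cong2[where f = scaleR] refl)
       (simp_all add: field_simps)
  have "(\<lambda>n. (1 / fact n) *\<^sub>R (?tD ^^ n) A) sums
      (1 *\<^sub>R A + (sin (l * t) / l) *\<^sub>R D A + ((1 - cos (l * t)) / l\<^sup>2) *\<^sub>R D (D A))"
    unfolding summand
    by (intro sums_add sums_scaleR_left sums_divide sums_diff sin_converges cos_converges
        sums_single[of 0 "\<lambda>_. 1 :: real"])
  then show ?thesis
    using op_exp_sums[OF lin, of A] by (simp add: sums_unique2)
qed

section \<open>The exponential map of the adjoint group\<close>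

lemma exp_G_eq_op_exp: "exp_G X = op_exp (lie X)"
  by (simp add: fun_eq_iff exp_G_def op_exp_def)

lemma bilinear_lie: "bilinear lie"
proof -
  have add: "lie X (Y + Z) = lie X Y + lie X Z" for X Y Z
    by (cases X; cases Y; cases Z) (simp add: coord_simps algebra_simps)
  have scale: "lie X (r *\<^sub>R Y) = r *\<^sub>R lie X Y" for X Y r
    by (cases X; cases Y) (simp add: coord_simps algebra_simps)
  have right: "linear (lie X)" for X
    by (intro linearI add scale)
  have "linear (\<lambda>X. lie X Y)" for Y
    by (subst lie_antisym) (intro linear_compose_neg right)
  with right show ?thesis by (simp add: bilinear_def)
qed

lemma linear_lie: "linear (lie X)"
  using bilinear_lie unfolding bilinear_def by blast

lemma lie_scale_left: "lie (t *\<^sub>R X) = (\<lambda>Y. t *\<^sub>R lie X Y)"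
  by (rule ext) (rule bilinear_lmul[OF bilinear_lie])

lemma exp_G_in_G2_group: "exp_G X \<in> G2_group"
proof -
  have Leibniz: "lie X (lie Y Z) = lie (lie X Y) Z + lie Y (lie X Z)" for Y Z
  proof -
    have "lie X (lie Y Z) - lie Y (lie X Z) - lie (lie X Y) Z = 0"
      using lie_jacobi[of X Y Z] lie_antisym[of "lie X Y" Z] lie_antisym[of X Z]
        linear_neg[OF linear_lie, of Y "lie X Z"]
      by simp
    then show ?thesis by (simp add: algebra_simps)
  qed
  then have "exp_G X (lie Y Z) = lie (exp_G X Y) (exp_G X Z)" for Y Z
    unfolding exp_G_eq_op_exp by (intro op_exp_bilinear bilinear_lie linear_lie)
  moreover have "linear (exp_G X)" "bij (exp_G X)"
    unfolding exp_G_eq_op_exp by (intro linear_op_exp bij_op_exp linear_lie)+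
  ultimately show ?thesis
    unfolding G2_group_def by blast
qed

lemma one_param_subgroup_subset_K:
  assumes "theta X = X"
  shows "one_param_subgroup X \<subseteq> K"
proof -
  have lin: "linear theta" and bij: "bij theta"
    using theta_in_G2_group by (auto simp: G2_group_def)
  have "theta (exp_G (t *\<^sub>R X) Y) = exp_G (t *\<^sub>R X) (theta Y)" for t Y
    unfolding exp_G_eq_op_exp
    by (rule op_exp_intertwine[OF linear_lie linear_lie lin])
       (simp add: theta_lie linear_cmul[OF lin] assms)
  then have "theta \<circ> exp_G (t *\<^sub>R X) \<circ> inv theta = exp_G (t *\<^sub>R X)" for t
    using bij by (simp add: fun_eq_iff bij_is_surj surj_f_inv_f)
  then show ?thesis
    by (auto simp: one_param_subgroup_def K_def exp_G_in_G2_group)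
qed

lemma exp_G_Rodrigues:
  assumes "l \<noteq> 0" "lie X (lie X (lie X A)) = - (l\<^sup>2) *\<^sub>R lie X A"
  shows "exp_G (t *\<^sub>R X) A
    = A + (sin (l * t) / l) *\<^sub>R lie X A + ((1 - cos (l * t)) / l\<^sup>2) *\<^sub>R lie X (lie X A)"
  unfolding exp_G_eq_op_exp lie_scale_left by (rule op_exp_Rodrigues[OF linear_lie assms])

lemma exp_G_eigenplane:
  assumes "l \<noteq> 0" "lie X (lie X A) = - (l\<^sup>2) *\<^sub>R A"
  shows "exp_G (t *\<^sub>R X) A = cos (l * t) *\<^sub>R A + (sin (l * t) / l) *\<^sub>R lie X A"
proof -
  have "lie X (lie X (lie X A)) = - (l\<^sup>2) *\<^sub>R lie X A"
    using assms(2) by (simp add: linear_neg[OF linear_lie] linear_cmul[OF linear_lie])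
  from exp_G_Rodrigues[OF assms(1) this] show ?thesis
    using assms by (simp add: algebra_simps diff_divide_distrib)
qed

lemma linear_exp_G: "linear (exp_G X)"
  using exp_G_in_G2_group by (simp add: G2_group_def)

lemma exp_G_fixes:
  assumes "lie X A = 0"
  shows "exp_G (t *\<^sub>R X) A = A"
  using exp_G_Rodrigues[of 1 X A t] assms by (simp add: linear_0[OF linear_lie])

section \<open>The two commuting rotations\<close>

definition short_gen :: g2
  where "short_gen = gm1 e1 + theta (gm1 e1)"

definition long_gen :: g2
  where "long_gen = gm3 (wedge e1 e2 *\<^sub>R e2) + theta (gm3 (wedge e1 e2 *\<^sub>R e2))"

lemma lie_short_gen:
  "lie short_gen (t, w, v, R, \<alpha>, p, s) =
    (vector [- 3 * w, 0], 2 * v$2 + t$1, vector [- R$1$1, - R$2$1 - 2 * w],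
     vector [vector [2 * v$1 + 2 * \<alpha>$1, 3 * \<alpha>$2], vector [3 * v$2, - v$1 - \<alpha>$1]],
     vector [- R$1$1, - R$1$2 - 2 * p], 2 * \<alpha>$2 + s$1, vector [- 3 * p, 0])"
  by (simp add: short_gen_def grading_defs coord_simps axis_def)

lemma lie_long_gen:
  "lie long_gen (t, w, v, R, \<alpha>, p, s) =
    (vector [- R$1$2, - R$1$1 - 2 * R$2$2], \<alpha>$2, vector [0, - p],
     vector [vector [0, t$1], vector [s$1, t$2 + s$2]],
     vector [0, - w], v$2, vector [- R$2$1, - R$1$1 - 2 * R$2$2])"
  by (simp add: long_gen_def grading_defs coord_simps axis_def)

text \<open>The involution \<open>parity\<close> is the natural action of \<open>refl_matrix \<in> GL\<^sub>2\<close>; since the determinant is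
  \<open>-1\<close>, each factor \<open>\<Lambda>\<^sup>2\<close> contributes a sign.\<close>

definition refl_matrix :: "real^2^2"
  where "refl_matrix = vector [vector [1, 0], vector [0, - 1]]"

fun parity :: "g2 \<Rightarrow> g2" where
  "parity (t, w, v, R, \<alpha>, p, s) =
    (- (refl_matrix *v t), - w, refl_matrix *v v, refl_matrix ** R ** refl_matrix,
     refl_matrix *v \<alpha>, - p, - (refl_matrix *v s))"

lemma short_gen_even:
  assumes "parity A = A"
  shows "lie short_gen (lie short_gen (lie short_gen A)) = - (2\<^sup>2) *\<^sub>R lie short_gen A"
  using assms
  by (cases A) (simp add: lie_short_gen refl_matrix_def coord_simps)

text \<open>The right-hand side expresses that \<open>(D\<^sup>2 + 1) (D\<^sup>2 + 9) A = 0\<close>: the weights of the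
  four-dimensional representation are \<open>\<plusminus>1\<close> and \<open>\<plusminus>3\<close>.\<close>

lemma short_gen_odd:
  assumes "parity A = - A"
  defines "D \<equiv> lie short_gen"
  shows "D (D (D (D A))) = - (10 *\<^sub>R D (D A)) - 9 *\<^sub>R A"
  using assms(1) unfolding D_def
  by (cases A) (simp add: lie_short_gen refl_matrix_def coord_simps)

lemma long_gen_even:
  assumes "parity A = A"
  shows "lie long_gen (lie long_gen (lie long_gen A)) = - (2\<^sup>2) *\<^sub>R lie long_gen A"
  using assms
  by (cases A) (simp add: lie_long_gen refl_matrix_def coord_simps)

lemma long_gen_odd:
  assumes "parity A = - A"
  shows "lie long_gen (lie long_gen A) = - (1\<^sup>2) *\<^sub>R A"
  using assms
  by (cases A) (simp add: lie_long_gen refl_matrix_def coord_simps)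

lemma parity_decomposition:
  obtains E O' where "parity E = E" "parity O' = - O'" "A = E + O'" "parity A = E - O'"
proof
  let ?E = "(1 / 2) *\<^sub>R (A + parity A)" and ?O = "(1 / 2) *\<^sub>R (A - parity A)"
  show "parity ?E = ?E" "parity ?O = - ?O"
    by (cases A; simp add: refl_matrix_def coord_simps)+
  show "A = ?E + ?O" "parity A = ?E - ?O"
    by (simp_all add: algebra_simps flip: scaleR_add_left)
qed

lemma exp_G_half_turn:
  fixes k :: int
  assumes "\<And>A. parity A = A \<Longrightarrow> exp_G X A = A"
    and "\<And>A. parity A = - A \<Longrightarrow> exp_G X A = (if even k then A else - A)"
  shows "exp_G X = (if even k then id else parity)"
proof
  fix A
  obtain E O' where "parity E = E" "parity O' = - O'" "A = E + O'" "parity A = E - O'"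
    by (rule parity_decomposition)
  with assms show "exp_G X A = (if even k then id else parity) A"
    by (simp add: linear_add[OF linear_exp_G])
qed

lemma exp_G_double_period:
  fixes k :: int
  assumes "lie X (lie X (lie X A)) = - (2\<^sup>2) *\<^sub>R lie X A"
  shows "exp_G ((pi * k) *\<^sub>R X) A = A"
  using exp_G_Rodrigues[OF _ assms, of "pi * k"] sin_npi_int[of "2 * k"] cos_npi_int[of "2 * k"]
  by (simp add: mult.left_commute)

text \<open>On the odd part the angles at time \<open>k\<pi>\<close> are \<open>k\<pi>\<close> and \<open>3k\<pi>\<close>, which have the same parity; hence the
  whole odd part is multiplied by \<open>(-1)\<^sup>k\<close>.\<close>

lemma exp_G_short_gen: "exp_G ((pi * of_int k) *\<^sub>R short_gen) = (if even k then id else parity)"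
proof (rule exp_G_half_turn)
  fix A
  show "exp_G ((pi * k) *\<^sub>R short_gen) A = A" if "parity A = A"
    using exp_G_double_period[OF short_gen_even[OF that]] .
  assume odd: "parity A = - A"
  let ?D = "lie short_gen"
  \<comment> \<open>Up to scalars, \<open>B\<close> and \<open>C\<close> are the projections of \<open>A\<close> to the kernels of \<open>D\<^sup>2 + 1\<close> and \<open>D\<^sup>2 + 9\<close>.\<close>
  define B where "B = ?D (?D A) + 9 *\<^sub>R A"
  define C where "C = ?D (?D A) + A"
  note lin = linear_add[OF linear_lie] linear_cmul[OF linear_lie]
  have B: "?D (?D B) = - (1\<^sup>2) *\<^sub>R B"
  proof -
    have "?D (?D B) = - (10 *\<^sub>R ?D (?D A)) - 9 *\<^sub>R A + 9 *\<^sub>R ?D (?D A)"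
      by (simp only: B_def lin short_gen_odd[OF odd])
    also have "\<dots> = - (1\<^sup>2) *\<^sub>R (?D (?D A) + 9 *\<^sub>R A)"
      by (cases "?D (?D A)"; cases A) (simp add: coord_simps)
    finally show ?thesis by (simp only: B_def)
  qed
  have C: "?D (?D C) = - (3\<^sup>2) *\<^sub>R C"
  proof -
    have "?D (?D C) = - (10 *\<^sub>R ?D (?D A)) - 9 *\<^sub>R A + ?D (?D A)"
      by (simp only: C_def lin(1) short_gen_odd[OF odd])
    also have "\<dots> = - (3\<^sup>2) *\<^sub>R (?D (?D A) + A)"
      by (cases "?D (?D A)"; cases A) (simp add: coord_simps)
    finally show ?thesis by (simp only: C_def)
  qed
  have A: "A = (1 / 8) *\<^sub>R (B - C)"
    unfolding B_def C_def by (cases "?D (?D A)"; cases A) (simp add: coord_simps)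
  let ?\<epsilon> = "if even k then 1 else - 1 :: real"
  have "exp_G ((pi * k) *\<^sub>R short_gen) B = ?\<epsilon> *\<^sub>R B"
    using exp_G_eigenplane[OF _ B, of "pi * k"] by simp
  moreover have "exp_G ((pi * k) *\<^sub>R short_gen) C = ?\<epsilon> *\<^sub>R C"
    using exp_G_eigenplane[OF _ C, of "pi * k"] sin_npi_int[of "3 * k"] cos_npi_int[of "3 * k"]
    by (simp add: mult.left_commute)
  ultimately have "exp_G ((pi * k) *\<^sub>R short_gen) A = ?\<epsilon> *\<^sub>R A"
    by (subst (1 2) A) (simp add: linear_cmul[OF linear_exp_G] linear_diff[OF linear_exp_G] algebra_simps)
  then show "exp_G ((pi * k) *\<^sub>R short_gen) A = (if even k then A else - A)" by simp
qed

lemma exp_G_long_gen: "exp_G ((pi * of_int k) *\<^sub>R long_gen) = (if even k then id else parity)"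
proof (rule exp_G_half_turn)
  fix A
  show "exp_G ((pi * k) *\<^sub>R long_gen) A = A" if "parity A = A"
    using exp_G_double_period[OF long_gen_even[OF that]] .
  show "exp_G ((pi * k) *\<^sub>R long_gen) A = (if even k then A else - A)" if "parity A = - A"
    using exp_G_eigenplane[OF _ long_gen_odd[OF that], of "pi * k"] by simp
qed

text \<open>The vectors \<open>[X, e\<^sub>1]\<close> and \<open>[X, [X, e\<^sub>1]]\<close> in the formula of Rodrigues lie in different degrees,
  so the coefficient \<open>1 - cos 2t\<close> of the second one has to vanish.\<close>

lemma short_rotation_fixing_e1:
  assumes "exp_G (t *\<^sub>R short_gen) (gm1 e1) = gm1 e1"
  obtains k :: int where "t = pi * k"
proof -
  have "parity (gm1 e1) = gm1 e1"
    by (simp add: grading_defs refl_matrix_def coord_simps axis_def)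
  from exp_G_Rodrigues[OF _ short_gen_even[OF this], of t] assms
  have "(sin (2 * t) / 2) *\<^sub>R lie short_gen (gm1 e1)
      + ((1 - cos (2 * t)) / 2\<^sup>2) *\<^sub>R lie short_gen (lie short_gen (gm1 e1)) = 0"
    by (simp add: add.assoc)
  then have "cos (2 * t) = 1"
    by (simp add: gm1_def lie_short_gen coord_simps axis_def zero_prod_def)
  then obtain k :: int where "2 * t = k * 2 * pi"
    by (auto simp: cos_one_2pi_int)
  then show thesis by (intro that[of k]) simp
qed

theorem lemma4p7:
  fixes X Y :: g2
  defines "X \<equiv> gm1 e1 + theta (gm1 e1)"
    and "Y \<equiv> gm3 (wedge e1 e2 *\<^sub>R e2) + theta (gm3 (wedge e1 e2 *\<^sub>R e2))"
  shows "one_param_subgroup X \<subseteq> K \<and> one_param_subgroup Y \<subseteq> K \<and>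
    card (one_param_subgroup X \<inter> one_param_subgroup Y) = 2"
proof -
  have X: "X = short_gen" and Y: "Y = long_gen"
    by (simp_all add: X_def Y_def short_gen_def long_gen_def)
  have "theta X = X" "theta Y = Y"
    by (simp_all add: X_def Y_def grading_defs coord_simps axis_def)
  then have K: "one_param_subgroup X \<subseteq> K" "one_param_subgroup Y \<subseteq> K"
    by (simp_all add: one_param_subgroup_subset_K)
  have "one_param_subgroup X \<inter> one_param_subgroup Y = {id, parity}"
  proof (intro subset_antisym subsetI)
    fix g assume "g \<in> one_param_subgroup X \<inter> one_param_subgroup Y"
    then obtain t s where g: "g = exp_G (t *\<^sub>R short_gen)" "g = exp_G (s *\<^sub>R long_gen)"
      unfolding one_param_subgroup_def X Y by blast
    have "lie long_gen (gm1 e1) = 0"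
      by (simp add: gm1_def lie_long_gen coord_simps axis_def zero_prod_def)
    then have "g (gm1 e1) = gm1 e1"
      unfolding g(2) by (rule exp_G_fixes)
    then obtain k :: int where "t = pi * k"
      unfolding g(1) by (rule short_rotation_fixing_e1)
    then show "g \<in> {id, parity}"
      using g(1) by (simp add: exp_G_short_gen)
  next
    fix g assume "g \<in> {id, parity}"
    then obtain k :: int where "g = (if even k then id else parity)"
      by (metis even_zero odd_one insertE singletonD)
    then have "g = exp_G ((pi * k) *\<^sub>R X)" "g = exp_G ((pi * k) *\<^sub>R Y)"
      by (simp_all only: X Y exp_G_short_gen exp_G_long_gen)
    then show "g \<in> one_param_subgroup X \<inter> one_param_subgroup Y"
      unfolding one_param_subgroup_def by blast
  qed
  \<comment> \<open>\<open>e\<^sub>1 \<and> e\<^sub>2\<close> is odd.\<close>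
  moreover have "id (gm2 1) \<noteq> parity (gm2 1)"
    by (simp add: gm2_def)
  then have "id \<noteq> parity" by metis
  ultimately show ?thesis
    using K by simp
qed

end
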